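(* Let $G$ be an abelian group, $R$ a $G$-graded commutative ring with identity, $M$ a $G$-graded $R$-module and $N$ a graded submodule of $M$. If $N$ is a graded weakly primal submodule of $M$, then the graded ideal $P$ of $R$ determined by $P\cap h(R)=GW(N)\cup\{0\}$ is a graded weakly prime ideal of $R$.
   Context: $R=\bigoplus_{g\in G}R_g$ with $R_gR_h\subseteq R_{gh}$, and $M=\bigoplus_{g\in G}M_g$ with $R_gM_h\subseteq M_{gh}$; $h(R)=\bigcup_g R_g$ and $h(M)=\bigcup_g M_g$ are the sets of homogeneous elements. A submodule of $M$ (resp. ideal of $R$) is graded if it is the direct sum of its intersections with the homogeneous components. A graded ideal $I$ of $R$ is graded weakly prime if for all $x,y\in h(R)$, $0\neq xy\in I$ implies $x\in I$ or $y\in I$. Let $N$ be a graded submodule of $M$. An element $x\in h(R)$ is graded weakly prime (GWP) to $N$ if, for every $m\in h(M)$, $0\neq xm\in N$ implies $m\in N$. It is not graded weakly prime (NGWP) to $N$ if there is $m\in h(M)\setminus N$ with $0\neq xm\in N$. $GW(N)$ denotes the set of all $x\in h(R)$ that are NGWP to $N$ (so $0\notin GW(N)$). $N$ is a graded weakly primal submodule of $M$ if there is a (necessarily unique) graded ideal $P$ of $R$ with $P\cap h(R)=GW(N)\cup\{0\}$. *)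

theory Defs
  imports "HOL-Algebra.Algebra"
begin

text \<open>
  Internal direct sums of additive subgroups: \<open>S = \<Oplus>\<^sub>i H i\<close> inside the abelian group underlying
  \<open>A\<close>, a ring or a module. Every element of \<open>S\<close> has a unique finitely supported decomposition.
  Families are extensional (undefined outside \<open>I\<close>), since otherwise uniqueness would fail.
\<close>

definition internal_direct_sum ::
    "'i set \<Rightarrow> ('a, 'm) ring_scheme \<Rightarrow> ('i \<Rightarrow> 'a set) \<Rightarrow> 'a set \<Rightarrow> bool" where
  "internal_direct_sum I A H S \<longleftrightarrow>
     additive_subgroup S A \<and>
     (\<forall>i\<in>I. additive_subgroup (H i) A \<and> H i \<subseteq> S) \<and>
     (\<forall>x\<in>S. \<exists>!f. f \<in> (\<Pi>\<^sub>E i\<in>I. H i) \<and> finite {i\<in>I. f i \<noteq> \<zero>\<^bsub>A\<^esub>} \<and>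
        x = (\<Oplus>\<^bsub>A\<^esub>i\<in>{i\<in>I. f i \<noteq> \<zero>\<^bsub>A\<^esub>}. f i))"

locale graded_cring = G: comm_group G + R: cring R
  for G :: "('g, 'k) monoid_scheme" (structure)
    and R :: "('a, 'm) ring_scheme" (structure)
    and Rg :: "'g \<Rightarrow> 'a set" +
  assumes ring_direct_sum: "internal_direct_sum (carrier G) R Rg (carrier R)"
    and ring_graded_mult:
      "\<lbrakk>g \<in> carrier G; h \<in> carrier G; x \<in> Rg g; y \<in> Rg h\<rbrakk>
        \<Longrightarrow> x \<otimes>\<^bsub>R\<^esub> y \<in> Rg (g \<otimes>\<^bsub>G\<^esub> h)"

locale graded_module = graded_cring G R Rg + module R M
  for G :: "('g, 'k) monoid_scheme" (structure)
    and R :: "('a, 'm) ring_scheme" (structure)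
    and Rg :: "'g \<Rightarrow> 'a set"
    and M :: "('a, 'b, 'n) module_scheme" (structure)
    and Mg :: "'g \<Rightarrow> 'b set" +
  assumes module_direct_sum: "internal_direct_sum (carrier G) M Mg (carrier M)"
    and graded_smult:
      "\<lbrakk>g \<in> carrier G; h \<in> carrier G; x \<in> Rg g; m \<in> Mg h\<rbrakk>
        \<Longrightarrow> x \<odot>\<^bsub>M\<^esub> m \<in> Mg (g \<otimes>\<^bsub>G\<^esub> h)"

text \<open>The set of homogeneous elements, \<open>h(R)\<close> or \<open>h(M)\<close>; it contains zero.\<close>

definition homogeneous :: "('g, 'k) monoid_scheme \<Rightarrow> ('g \<Rightarrow> 'a set) \<Rightarrow> 'a set" where
  "homogeneous G Xg = (\<Union>g\<in>carrier G. Xg g)"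

definition graded_submodule ::
    "('g, 'k) monoid_scheme \<Rightarrow> ('a, 'm) ring_scheme \<Rightarrow> ('a, 'b, 'n) module_scheme \<Rightarrow>
     ('g \<Rightarrow> 'b set) \<Rightarrow> 'b set \<Rightarrow> bool" where
  "graded_submodule G R M Mg N \<longleftrightarrow>
     submodule N R M \<and> internal_direct_sum (carrier G) M (\<lambda>g. N \<inter> Mg g) N"

definition graded_ideal ::
    "('g, 'k) monoid_scheme \<Rightarrow> ('a, 'm) ring_scheme \<Rightarrow> ('g \<Rightarrow> 'a set) \<Rightarrow> 'a set \<Rightarrow> bool" where
  "graded_ideal G R Rg I \<longleftrightarrow>
     ideal I R \<and> internal_direct_sum (carrier G) R (\<lambda>g. I \<inter> Rg g) I"

text \<open>No properness is required of a graded weakly prime ideal.\<close>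

definition graded_weakly_prime ::
    "('g, 'k) monoid_scheme \<Rightarrow> ('a, 'm) ring_scheme \<Rightarrow> ('g \<Rightarrow> 'a set) \<Rightarrow> 'a set \<Rightarrow> bool" where
  "graded_weakly_prime G R Rg I \<longleftrightarrow>
     graded_ideal G R Rg I \<and>
     (\<forall>x\<in>homogeneous G Rg. \<forall>y\<in>homogeneous G Rg.
        x \<otimes>\<^bsub>R\<^esub> y \<noteq> \<zero>\<^bsub>R\<^esub> \<and> x \<otimes>\<^bsub>R\<^esub> y \<in> I \<longrightarrow> x \<in> I \<or> y \<in> I)"

text \<open>The homogeneous ring element \<open>x\<close> is not graded weakly prime to \<open>N\<close>.\<close>

definition NGWP ::
    "('g, 'k) monoid_scheme \<Rightarrow> ('a, 'b, 'n) module_scheme \<Rightarrow> ('g \<Rightarrow> 'b set) \<Rightarrow> 'b set \<Rightarrow>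
     'a \<Rightarrow> bool" where
  "NGWP G M Mg N x \<longleftrightarrow>
     (\<exists>m \<in> homogeneous G Mg - N. x \<odot>\<^bsub>M\<^esub> m \<noteq> \<zero>\<^bsub>M\<^esub> \<and> x \<odot>\<^bsub>M\<^esub> m \<in> N)"

definition GW ::
    "('g, 'k) monoid_scheme \<Rightarrow> ('g \<Rightarrow> 'a set) \<Rightarrow> ('a, 'b, 'n) module_scheme \<Rightarrow>
     ('g \<Rightarrow> 'b set) \<Rightarrow> 'b set \<Rightarrow> 'a set" where
  "GW G Rg M Mg N = {x \<in> homogeneous G Rg. NGWP G M Mg N x}"

text \<open>\<open>P\<close> is the graded ideal determined by \<open>N\<close>; there is at most one such \<open>P\<close>, because a graded
  ideal is determined by its homogeneous elements.\<close>

definition GW_ideal ::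
    "('g, 'k) monoid_scheme \<Rightarrow> ('a, 'm) ring_scheme \<Rightarrow> ('g \<Rightarrow> 'a set) \<Rightarrow>
     ('a, 'b, 'n) module_scheme \<Rightarrow> ('g \<Rightarrow> 'b set) \<Rightarrow> 'b set \<Rightarrow> 'a set \<Rightarrow> bool" where
  "GW_ideal G R Rg M Mg N P \<longleftrightarrow>
     graded_ideal G R Rg P \<and> P \<inter> homogeneous G Rg = GW G Rg M Mg N \<union> {\<zero>\<^bsub>R\<^esub>}"

definition graded_weakly_primal ::
    "('g, 'k) monoid_scheme \<Rightarrow> ('a, 'm) ring_scheme \<Rightarrow> ('g \<Rightarrow> 'a set) \<Rightarrow>
     ('a, 'b, 'n) module_scheme \<Rightarrow> ('g \<Rightarrow> 'b set) \<Rightarrow> 'b set \<Rightarrow> bool" where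
  "graded_weakly_primal G R Rg M Mg N \<longleftrightarrow>
     graded_submodule G R M Mg N \<and> (\<exists>P. GW_ideal G R Rg M Mg N P)"

end

theory Submission
  imports Defs
begin

text \<open>
  Suppose \<open>0 \<noteq> x y \<in> P\<close> with \<open>x\<close> and \<open>y\<close> homogeneous. Then \<open>x y\<close> is NGWP to \<open>N\<close>: there is a
  homogeneous \<open>m \<notin> N\<close> with \<open>0 \<noteq> x y m \<in> N\<close>. The element \<open>y m\<close>, again homogeneous and nonzero,
  decides which factor lies in \<open>P\<close>: if \<open>y m \<in> N\<close>, then \<open>m\<close> itself witnesses that \<open>y\<close> is NGWP
  to \<open>N\<close>, and otherwise \<open>y m\<close> witnesses this for \<open>x\<close>.
\<close>

lemma internal_direct_sum_homogeneous_subset: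
  assumes "internal_direct_sum (carrier G) A H S"
  shows "homogeneous G H \<subseteq> S"
  using assms unfolding internal_direct_sum_def homogeneous_def by blast

context graded_module
begin

lemma homogeneous_mult:
  assumes "x \<in> homogeneous G Rg" and "y \<in> homogeneous G Rg"
  shows "x \<otimes>\<^bsub>R\<^esub> y \<in> homogeneous G Rg"
  using assms ring_graded_mult G.m_closed unfolding homogeneous_def by blast

lemma homogeneous_smult:
  assumes "x \<in> homogeneous G Rg" and "m \<in> homogeneous G Mg"
  shows "x \<odot>\<^bsub>M\<^esub> m \<in> homogeneous G Mg"
  using assms graded_smult G.m_closed unfolding homogeneous_def by blast

lemma NGWP_mult_imp:
  assumes x: "x \<in> homogeneous G Rg" and y: "y \<in> homogeneous G Rg"
    and "NGWP G M Mg N (x \<otimes>\<^bsub>R\<^esub> y)"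
  shows "NGWP G M Mg N x \<or> NGWP G M Mg N y"
proof -
  obtain m where m: "m \<in> homogeneous G Mg" "m \<notin> N"
    and nz: "(x \<otimes>\<^bsub>R\<^esub> y) \<odot>\<^bsub>M\<^esub> m \<noteq> \<zero>\<^bsub>M\<^esub>" and mem: "(x \<otimes>\<^bsub>R\<^esub> y) \<odot>\<^bsub>M\<^esub> m \<in> N"
    using assms(3) unfolding NGWP_def by blast
  have carr: "x \<in> carrier R" "y \<in> carrier R" "m \<in> carrier M"
    using x y m(1) internal_direct_sum_homogeneous_subset[OF ring_direct_sum]
      internal_direct_sum_homogeneous_subset[OF module_direct_sum] by blast+
  have assoc: "(x \<otimes>\<^bsub>R\<^esub> y) \<odot>\<^bsub>M\<^esub> m = x \<odot>\<^bsub>M\<^esub> (y \<odot>\<^bsub>M\<^esub> m)"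
    using carr by (rule smult_assoc1)
  show ?thesis
  proof (cases "y \<odot>\<^bsub>M\<^esub> m \<in> N")
    case True
    have "y \<odot>\<^bsub>M\<^esub> m \<noteq> \<zero>\<^bsub>M\<^esub>"
      using nz carr(1) unfolding assoc by auto
    with True m show ?thesis unfolding NGWP_def by blast
  next
    case False
    with nz mem homogeneous_smult[OF y m(1)] show ?thesis
      unfolding NGWP_def assoc by blast
  qed
qed

end

theorem theorem2p10:
  fixes G :: "('g, 'k) monoid_scheme"
    and R :: "('a, 'm) ring_scheme"
    and Rg :: "'g \<Rightarrow> 'a set"
    and M :: "('a, 'b, 'n) module_scheme"
    and Mg :: "'g \<Rightarrow> 'b set"
    and N :: "'b set"
    and P :: "'a set"
  assumes "graded_module G R Rg M Mg"
    and "graded_submodule G R M Mg N"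
    and "graded_weakly_primal G R Rg M Mg N"
    and "graded_ideal G R Rg P"
    and "P \<inter> homogeneous G Rg = GW G Rg M Mg N \<union> {\<zero>\<^bsub>R\<^esub>}"
  shows "graded_weakly_prime G R Rg P"
proof -
  interpret graded_module G R Rg M Mg by (rule assms(1))
  have "x \<in> P \<or> y \<in> P"
    if x: "x \<in> homogeneous G Rg" and y: "y \<in> homogeneous G Rg"
      and nz: "x \<otimes>\<^bsub>R\<^esub> y \<noteq> \<zero>\<^bsub>R\<^esub>" and P: "x \<otimes>\<^bsub>R\<^esub> y \<in> P" for x y
  proof -
    have "NGWP G M Mg N (x \<otimes>\<^bsub>R\<^esub> y)"
      using assms(5) nz P homogeneous_mult[OF x y] unfolding GW_def by blast
    then have "NGWP G M Mg N x \<or> NGWP G M Mg N y"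
      by (rule NGWP_mult_imp[OF x y])
    then show ?thesis
      using assms(5) x y unfolding GW_def by blast
  qed
  with assms(4) show ?thesis
    unfolding graded_weakly_prime_def by blast
qed

end
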